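(* Let $(\mathcal H,\omega:=\partial\alpha)$ be an exact symplectic Lie algebra and let $x_o\in\mathcal H$ be the vector such that $\omega(x_o,\cdot)=\alpha$. Let $(\psi,f)\in \mathrm{End}(\mathcal H)\times\mathcal H^*$ be such that, for all $x,y\in\mathcal H$, $f([x,y])=0$ and $$\psi([x,y])=[\psi(x),y]+[x,\psi(y)]-f(x)\psi(y)+f(y)\psi(x),$$ and let $\mathcal G=\mathcal H\oplus\mathbb R e_o$ be the Lie algebra whose bracket extends that of $\mathcal H$ and satisfies $[x,e_o]=\psi(x)+f(x)e_o$ for $x\in\mathcal H$. Let $e_o^*\in\mathcal G^*$ be defined by $\langle e_o^*,e_o\rangle=1$ and $\langle e_o^*,\mathcal H\rangle=0$, and regard $\alpha$ as a linear form on $\mathcal G$ by setting $\alpha(e_o)=0$. Then, for $s\in\mathbb R$, the form $\eta_s:=\alpha+s e_o^*$ is a contact form on $\mathcal G$ if and only if $$\omega(x_o,\psi(x_o))+s\,(1+f(x_o))\neq 0 .$$ Thus the Lie algebras $\mathcal G=\mathcal H\oplus\mathbb R e_o$ of this type which admit a contact form $\eta_s$ correspond to the couples $(\psi,f)$ satisfying this inequality for some $s\in\mathbb R$.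
   Context: All Lie algebras are real and finite dimensional. For a linear form $\eta$ on a Lie algebra $\mathcal G$, $\partial\eta(x,y):=-\eta([x,y])$. A contact form on a Lie algebra $\mathcal G$ of dimension $2n+1$ is a linear form $\eta$ with $(\partial\eta)^n\wedge\eta\neq0$. An exact symplectic Lie algebra $(\mathcal H,\partial\alpha)$ is a Lie algebra $\mathcal H$ with a linear form $\alpha\in\mathcal H^*$ such that the 2-form $\partial\alpha$ is nondegenerate. The conditions on $(\psi,f)$ are exactly those making the given bracket on $\mathcal H\oplus\mathbb R e_o$ a Lie bracket, and every Lie algebra containing $\mathcal H$ as a codimension 1 subalgebra arises in this way. *)

theory Defs
  imports "HOL-Analysis.Analysis"
begin

definition lie_algebra :: "('a::real_vector \<Rightarrow> 'a \<Rightarrow> 'a) \<Rightarrow> bool" where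
  "lie_algebra br \<longleftrightarrow>
     (\<exists>B::'a set. finite B \<and> span B = UNIV) \<and>
     bilinear br \<and>
     (\<forall>x. br x x = 0) \<and>
     (\<forall>x y z. br x (br y z) + br y (br z x) + br z (br x y) = 0)"

definition lie_diff :: "('a \<Rightarrow> 'a \<Rightarrow> 'a) \<Rightarrow> ('a \<Rightarrow> real) \<Rightarrow> 'a \<Rightarrow> 'a \<Rightarrow> real" where
  "lie_diff br \<eta> x y = - \<eta> (br x y)"

definition exact_symplectic ::
    "('a::real_vector \<Rightarrow> 'a \<Rightarrow> 'a) \<Rightarrow> ('a \<Rightarrow> real) \<Rightarrow> bool" where
  "exact_symplectic br \<alpha> \<longleftrightarrow>
     lie_algebra br \<and> linear \<alpha> \<and>
     (\<forall>x. (\<forall>y. lie_diff br \<alpha> x y = 0) \<longrightarrow> x = 0)"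

text \<open>
  A form of degree \<open>k\<close> is represented as a function of a sequence of vectors that
  only inspects the entries with index below \<open>k\<close>. The degrees are therefore explicit
  arguments of the wedge product, which is normalised so that
  \<open>(a \<and> b)(v\<^sub>0, v\<^sub>1) = a v\<^sub>0 * b v\<^sub>1 - a v\<^sub>1 * b v\<^sub>0\<close> for linear forms \<open>a\<close>, \<open>b\<close>.
\<close>

definition wedge ::
    "nat \<Rightarrow> nat \<Rightarrow> ((nat \<Rightarrow> 'a) \<Rightarrow> real) \<Rightarrow> ((nat \<Rightarrow> 'a) \<Rightarrow> real) \<Rightarrow> (nat \<Rightarrow> 'a) \<Rightarrow> real" where
  "wedge p q a b v =
     (\<Sum>\<sigma> | \<sigma> permutes {..<p + q}.
        of_int (sign \<sigma>) * a (\<lambda>i. v (\<sigma> i)) * b (\<lambda>i. v (\<sigma> (p + i)))) / (fact p * fact q)"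

definition form1 :: "('a \<Rightarrow> real) \<Rightarrow> (nat \<Rightarrow> 'a) \<Rightarrow> real" where
  "form1 \<eta> v = \<eta> (v 0)"

definition form2 :: "('a \<Rightarrow> 'a \<Rightarrow> real) \<Rightarrow> (nat \<Rightarrow> 'a) \<Rightarrow> real" where
  "form2 \<omega> v = \<omega> (v 0) (v 1)"

primrec wedge_power2 :: "((nat \<Rightarrow> 'a) \<Rightarrow> real) \<Rightarrow> nat \<Rightarrow> (nat \<Rightarrow> 'a) \<Rightarrow> real" where
  "wedge_power2 \<omega> 0 = (\<lambda>v. 1)"
| "wedge_power2 \<omega> (Suc k) = wedge (2 * k) 2 (wedge_power2 \<omega> k) \<omega>"

definition contact_form ::
    "('a::real_vector \<Rightarrow> 'a \<Rightarrow> 'a) \<Rightarrow> ('a \<Rightarrow> real) \<Rightarrow> bool" where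
  "contact_form br \<eta> \<longleftrightarrow>
     linear \<eta> \<and>
     (\<exists>n. dim (UNIV :: 'a set) = 2 * n + 1 \<and>
        wedge (2 * n) 1 (wedge_power2 (form2 (lie_diff br \<eta>)) n) (form1 \<eta>) \<noteq> (\<lambda>v. 0))"

definition extension_datum ::
    "('h::real_vector \<Rightarrow> 'h \<Rightarrow> 'h) \<Rightarrow> ('h \<Rightarrow> 'h) \<Rightarrow> ('h \<Rightarrow> real) \<Rightarrow> bool" where
  "extension_datum br \<psi> f \<longleftrightarrow>
     linear \<psi> \<and> linear f \<and>
     (\<forall>x y. f (br x y) = 0) \<and>
     (\<forall>x y. \<psi> (br x y) = br (\<psi> x) y + br x (\<psi> y) - f x *\<^sub>R \<psi> y + f y *\<^sub>R \<psi> x)"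

text \<open>
  \<open>\<H> \<oplus> \<real> e\<^sub>o\<close> is the product \<open>'h \<times> real\<close> with \<open>e\<^sub>o = (0, 1)\<close> and \<open>x \<in> \<H>\<close> identified with
  \<open>(x, 0)\<close>. The formula is the bilinear alternating extension of the bracket of \<open>\<H>\<close>
  determined by \<open>[x, e\<^sub>o] = \<psi> x + f x e\<^sub>o\<close>.
\<close>

definition ext_bracket ::
    "('h::real_vector \<Rightarrow> 'h \<Rightarrow> 'h) \<Rightarrow> ('h \<Rightarrow> 'h) \<Rightarrow> ('h \<Rightarrow> real) \<Rightarrow>
     'h \<times> real \<Rightarrow> 'h \<times> real \<Rightarrow> 'h \<times> real" where
  "ext_bracket br \<psi> f u v =
     (br (fst u) (fst v) + snd v *\<^sub>R \<psi> (fst u) - snd u *\<^sub>R \<psi> (fst v),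
      snd v * f (fst u) - snd u * f (fst v))"

lemma ext_bracket_base:
  "ext_bracket br \<psi> f (x, 0) (y, 0) = (br x y, 0)"
  by (simp add: ext_bracket_def)

lemma ext_bracket_e\<^sub>o:
  assumes "lie_algebra br" "extension_datum br \<psi> f"
  shows "ext_bracket br \<psi> f (x, 0) (0, 1) = (\<psi> x, f x)"
  using assms
  by (simp add: ext_bracket_def lie_algebra_def extension_datum_def bilinear_rzero)

definition eta_form :: "('h \<Rightarrow> real) \<Rightarrow> real \<Rightarrow> 'h \<times> real \<Rightarrow> real" where
  "eta_form \<alpha> s u = \<alpha> (fst u) + s * snd u"

end

theory Submission
  imports Defs
begin

text \<open>
  Write \<open>\<omega> = \<partial>\<alpha>\<close> and \<open>\<eta> = \<eta>\<^sub>s\<close>. On \<open>\<H>\<close> the form \<open>\<partial>\<eta>\<close> restricts to \<open>\<omega>\<close>, because \<open>\<eta>\<close>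
  restricts to \<open>\<alpha>\<close> and \<open>\<H>\<close> is a subalgebra. Since \<open>\<omega>\<close> is nondegenerate, \<open>\<H>\<close> has even
  dimension \<open>2n\<close> and the radical of \<open>\<partial>\<eta>\<close> is a line spanned by a vector \<open>u = h + e\<^sub>o\<close>, where
  \<open>h \<in> \<H>\<close> solves \<open>\<omega>(h, y) = - \<alpha>(\<psi> y) - s f(y)\<close> for all \<open>y \<in> \<H>\<close>. The form \<open>(\<partial>\<eta>)\<^sup>n \<and> \<eta>\<close> is
  nonzero exactly when \<open>\<eta>(u) \<noteq> 0\<close>, and
  \<open>\<eta>(u) = \<alpha>(h) + s = - \<omega>(h, x\<^sub>o) + s = \<alpha>(\<psi> x\<^sub>o) + s f(x\<^sub>o) + s\<close>,
  which is \<open>\<omega>(x\<^sub>o, \<psi> x\<^sub>o) + s (1 + f(x\<^sub>o))\<close>. This computation is \<open>contact_form_eta_form_iff\<close>.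

  The linear algebra behind it is \<open>contact_criterion\<close>. Up to a positive factor,
  \<open>(\<partial>\<eta>)\<^sup>n \<and> \<eta>\<close> is the alternation of the function
  \<open>\<omega>(v\<^sub>0, v\<^sub>1) \<dots> \<omega>(v\<^sub>2\<^sub>n\<^sub>-\<^sub>2, v\<^sub>2\<^sub>n\<^sub>-\<^sub>1) \<eta>(v\<^sub>2\<^sub>n)\<close> (now with \<open>\<omega>\<close> for \<open>\<partial>\<eta>\<close>), by
  \<open>wedge_power2_wedge_form1\<close>. If \<open>\<eta>(u) = 0\<close>, the alternation is a top degree form that vanishes
  as soon as \<open>u\<close> is an argument, and any \<open>2n + 1\<close> vectors have a nontrivial combination that is a
  multiple of \<open>u\<close>; exchanging it for one of them shows that the form is zero
  (\<open>alternation_contact_term_vanishes\<close>). If \<open>\<eta>(u) \<noteq> 0\<close>, the form is evaluated on a symplectic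
  basis of a complement followed by \<open>u\<close>: a permutation contributes only if it maps the pairs
  \<open>{2i, 2i+1}\<close> to such pairs and fixes \<open>2n\<close>, and then its sign cancels the sign of the
  product, so that every contribution is \<open>\<eta>(u)\<close> and nothing cancels
  (\<open>signed_contact_term_hyperbolic\<close>).

  For the correspondence between couples and brackets, the Jacobi identity on two vectors of
  \<open>\<H>\<close> and \<open>e\<^sub>o\<close> is the pair of conditions on \<open>(\<psi>, f)\<close>, and \<open>(\<psi>, f)\<close> is read off from
  \<open>[x, e\<^sub>o]\<close> (\<open>lie_algebra_ext_bracket\<close> and \<open>codim1_extension_datum\<close>).
\<close>

section \<open>Alternation of functions of several vectors\<close>

definition alternation :: "nat \<Rightarrow> ((nat \<Rightarrow> 'a) \<Rightarrow> real) \<Rightarrow> (nat \<Rightarrow> 'a) \<Rightarrow> real" where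
  "alternation m A v = (\<Sum>\<sigma> | \<sigma> permutes {..<m}. of_int (sign \<sigma>) * A (\<lambda>i. v (\<sigma> i)))"

lemma finite_permutes_lessThan [simp]: "finite {\<sigma>. \<sigma> permutes {..<m::nat}}"
  by (rule finite_permutations) simp

lemma sign_compose_permutes:
  assumes "\<sigma> permutes {..<m::nat}" "\<tau> permutes {..<m}"
  shows "sign (\<sigma> \<circ> \<tau>) = sign \<sigma> * sign \<tau>"
  using assms permutation_permutes by (intro sign_compose) blast+

lemma alternation_permute:
  assumes "\<tau> permutes {..<m}"
  shows "alternation m A (\<lambda>i. v (\<tau> i)) = of_int (sign \<tau>) * alternation m A v"
proof -
  let ?g = "\<lambda>\<sigma>. of_int (sign \<tau>) * (of_int (sign \<sigma>) * A (\<lambda>i. v (\<sigma> i)))"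
  have "of_int (sign \<tau>) * alternation m A v = sum ?g {\<sigma>. \<sigma> permutes {..<m}}"
    by (simp add: alternation_def sum_distrib_left)
  also have "\<dots> = (\<Sum>\<sigma> | \<sigma> permutes {..<m}. ?g (\<tau> \<circ> \<sigma>))"
    by (rule setum_permutations_compose_left[OF assms])
  also have "\<dots> = alternation m A (\<lambda>i. v (\<tau> i))"
    unfolding alternation_def
    by (intro sum.cong)
      (auto simp: sign_compose_permutes[OF assms] mult.assoc[symmetric] simp flip: of_int_mult)
  finally show ?thesis ..
qed

lemma alternation_repeated:
  assumes "i < m" "j < m" "i \<noteq> j" "v i = v j"
  shows "alternation m A v = 0"
proof -
  have "(\<lambda>k. v (Transposition.transpose i j k)) = v"
    using assms(4) by (auto simp: Transposition.transpose_def)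
  then show ?thesis
    using alternation_permute[of "Transposition.transpose i j" m A v] assms
    by (simp add: sign_swap_id permutes_swap_id)
qed

text \<open>
  Replacing \<open>v j\<close> before permuting is replacing the entry in position \<open>inv \<sigma> j\<close> afterwards. This
  carries linearity and vanishing in one slot from a function to its alternation.
\<close>

lemma update_permute:
  assumes "\<sigma> permutes S"
  shows "(\<lambda>i. (v(j := x)) (\<sigma> i)) = (\<lambda>i. v (\<sigma> i))(inv \<sigma> j := x)"
proof -
  have "\<sigma> i = j \<longleftrightarrow> i = inv \<sigma> j" for i
    using permutes_inv_eq[OF assms, of j i] by auto
  then show ?thesis by (simp add: fun_upd_def)
qed

lemma inv_permutes_lessThan:
  assumes "\<sigma> permutes {..<m::nat}" "j < m"
  shows "inv \<sigma> j < m"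
  using permutes_in_image[OF permutes_inv[OF assms(1)], of j] assms(2) by simp

lemma alternation_linear_slot:
  fixes A :: "(nat \<Rightarrow> 'a::real_vector) \<Rightarrow> real"
  assumes A: "\<And>w p. p < m \<Longrightarrow> linear (\<lambda>x. A (w(p := x)))" and "j < m"
  shows "linear (\<lambda>x. alternation m A (v(j := x)))"
proof -
  have "linear (\<lambda>x. of_int (sign \<sigma>) * A (\<lambda>i. (v(j := x)) (\<sigma> i)))"
    if "\<sigma> permutes {..<m}" for \<sigma>
    using linear_compose_scale_right[OF A[OF inv_permutes_lessThan[OF that \<open>j < m\<close>]],
        of "of_int (sign \<sigma>)"]
    unfolding update_permute[OF that] by simp
  then show ?thesis
    unfolding alternation_def by (intro linear_compose_sum) auto
qed

text \<open>
  By linearity in the slot \<open>j\<close> the left side is a combination of values at families in which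
  \<open>v j\<close> is replaced by \<open>v i\<close>; for \<open>i \<noteq> j\<close> such a family has a repeated vector. This is the exchange
  step that turns a linear relation into the vanishing of a form.
\<close>

lemma alternation_combination_slot:
  fixes A :: "(nat \<Rightarrow> 'a::real_vector) \<Rightarrow> real"
  assumes A: "\<And>w p. p < m \<Longrightarrow> linear (\<lambda>x. A (w(p := x)))" and j: "j < m"
  shows "alternation m A (v(j := \<Sum>i<m. c i *\<^sub>R v i)) = c j * alternation m A v"
proof -
  interpret L: linear "\<lambda>x. alternation m A (v(j := x))"
    using alternation_linear_slot[OF A j] .
  have "alternation m A (v(j := \<Sum>i<m. c i *\<^sub>R v i))
      = (\<Sum>i<m. c i * alternation m A (v(j := v i)))"
    by (simp add: L.sum L.scale)
  also have "\<dots> = (\<Sum>i<m. if i = j then c j * alternation m A v else 0)"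
  proof (intro sum.cong refl)
    fix i assume "i \<in> {..<m}"
    then show "c i * alternation m A (v(j := v i)) = (if i = j then c j * alternation m A v else 0)"
      using alternation_repeated[of i m j "v(j := v i)" A] j by auto
  qed
  also have "\<dots> = c j * alternation m A v"
    using j by simp
  finally show ?thesis .
qed

text \<open>
  A permutation \<open>\<tau>\<close> of the first \<open>p\<close> places can be absorbed into the permutation of all
  \<open>p + q\<close> places: it keeps the last \<open>q\<close> places, and \<open>\<sigma> \<mapsto> \<sigma> \<circ> \<tau>\<close> is a bijection multiplying signs.
  Each of the \<open>p!\<close> choices of \<open>\<tau>\<close> gives the same sum, which cancels the \<open>p!\<close> in the normalisation
  of the wedge product. Hence iterated wedge products are single alternations.
\<close>

lemma wedge_alternation:
  assumes a: "\<And>v. a v = c * alternation p A v"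
    and A: "\<And>v w. (\<And>i. i < p \<Longrightarrow> v i = w i) \<Longrightarrow> A v = A w"
  shows "wedge p q a b v = c / fact q * alternation (p + q) (\<lambda>v. A v * b (\<lambda>i. v (p + i))) v"
proof -
  let ?S = "{\<sigma>. \<sigma> permutes {..<p + q}}" and ?T = "{\<tau>. \<tau> permutes {..<p}}"
  let ?g = "\<lambda>\<sigma>. of_int (sign \<sigma>) * A (\<lambda>i. v (\<sigma> i)) * b (\<lambda>i. v (\<sigma> (p + i)))"
  have sub: "\<tau> permutes {..<p + q}" if "\<tau> permutes {..<p}" for \<tau>
    using that by (rule permutes_subset) auto
  have "(\<Sum>\<sigma>\<in>?S. of_int (sign \<sigma>) * a (\<lambda>i. v (\<sigma> i)) * b (\<lambda>i. v (\<sigma> (p + i))))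
      = (\<Sum>\<sigma>\<in>?S. \<Sum>\<tau>\<in>?T. c * ?g (\<sigma> \<circ> \<tau>))"
  proof (intro sum.cong refl)
    fix \<sigma> assume "\<sigma> \<in> ?S"
    then have "(\<Sum>\<tau>\<in>?T. c * ?g (\<sigma> \<circ> \<tau>))
      = (\<Sum>\<tau>\<in>?T. of_int (sign \<sigma>) * (c * (of_int (sign \<tau>) * A (\<lambda>i. v (\<sigma> (\<tau> i)))))
                  * b (\<lambda>i. v (\<sigma> (p + i))))"
      by (intro sum.cong refl)
        (simp add: sign_compose_permutes[OF _ sub] permutes_not_in[where S="{..<p}"] algebra_simps)
    then show "of_int (sign \<sigma>) * a (\<lambda>i. v (\<sigma> i)) * b (\<lambda>i. v (\<sigma> (p + i)))
        = (\<Sum>\<tau>\<in>?T. c * ?g (\<sigma> \<circ> \<tau>))"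
      by (simp add: a alternation_def sum_distrib_left sum_distrib_right)
  qed
  also have "\<dots> = (\<Sum>\<tau>\<in>?T. \<Sum>\<sigma>\<in>?S. c * ?g (\<sigma> \<circ> \<tau>))"
    by (rule sum.swap)
  also have "\<dots> = (\<Sum>\<tau>\<in>?T. \<Sum>\<sigma>\<in>?S. c * ?g \<sigma>)"
  proof (rule sum.cong[OF refl])
    fix \<tau> assume "\<tau> \<in> ?T"
    then show "(\<Sum>\<sigma>\<in>?S. c * ?g (\<sigma> \<circ> \<tau>)) = (\<Sum>\<sigma>\<in>?S. c * ?g \<sigma>)"
      using sum_permutations_compose_right[OF sub, of \<tau> "\<lambda>\<sigma>. c * ?g \<sigma>"] by simp
  qed
  also have "\<dots> = fact p * (c * alternation (p + q) (\<lambda>v. A v * b (\<lambda>i. v (p + i))) v)"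
    by (simp add: card_permutations[of "{..<p}" p] alternation_def sum_distrib_left mult.assoc)
  finally show ?thesis
    by (simp add: wedge_def)
qed

definition pair_product :: "('a \<Rightarrow> 'a \<Rightarrow> real) \<Rightarrow> nat \<Rightarrow> (nat \<Rightarrow> 'a) \<Rightarrow> real" where
  "pair_product \<omega> n v = (\<Prod>i<n. \<omega> (v (2 * i)) (v (2 * i + 1)))"

lemma pair_product_cong:
  "(\<And>i. i < 2 * n \<Longrightarrow> v i = w i) \<Longrightarrow> pair_product \<omega> n v = pair_product \<omega> n w"
  unfolding pair_product_def by (intro prod.cong) auto

lemma wedge_power2_alternation:
  "wedge_power2 (form2 \<omega>) n v = (1 / 2 ^ n) * alternation (2 * n) (pair_product \<omega> n) v"
proof (induction n arbitrary: v)
  case 0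
  show ?case by (simp add: alternation_def pair_product_def)
next
  case (Suc n)
  have "wedge (2 * n) 2 (wedge_power2 (form2 \<omega>) n) (form2 \<omega>) v
     = 1 / 2 ^ n / fact 2 *
       alternation (2 * n + 2) (\<lambda>v. pair_product \<omega> n v * form2 \<omega> (\<lambda>i. v (2 * n + i))) v"
    by (rule wedge_alternation[OF Suc.IH pair_product_cong])
  moreover have "(\<lambda>v. pair_product \<omega> n v * form2 \<omega> (\<lambda>i. v (2 * n + i))) = pair_product \<omega> (Suc n)"
    by (simp add: fun_eq_iff pair_product_def form2_def)
  ultimately show ?case
    by (simp add: mult.commute)
qed

definition contact_term ::
    "('a \<Rightarrow> 'a \<Rightarrow> real) \<Rightarrow> ('a \<Rightarrow> real) \<Rightarrow> nat \<Rightarrow> (nat \<Rightarrow> 'a) \<Rightarrow> real" where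
  "contact_term \<omega> \<eta> n v = pair_product \<omega> n v * \<eta> (v (2 * n))"

text \<open>
  The factor \<open>1 / 2 ^ n\<close> collects the \<open>2!\<close> from each wedge product with \<open>\<omega>\<close>; being positive, it
  does not affect whether the form vanishes.
\<close>

lemma wedge_power2_wedge_form1:
  "wedge (2 * n) 1 (wedge_power2 (form2 \<omega>) n) (form1 \<eta>) v
     = (1 / 2 ^ n) * alternation (2 * n + 1) (contact_term \<omega> \<eta> n) v"
proof -
  have "wedge (2 * n) 1 (wedge_power2 (form2 \<omega>) n) (form1 \<eta>) v
     = 1 / 2 ^ n / fact 1 *
       alternation (2 * n + 1) (\<lambda>v. pair_product \<omega> n v * form1 \<eta> (\<lambda>i. v (2 * n + i))) v"
    by (rule wedge_alternation[OF wedge_power2_alternation pair_product_cong])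
  then show ?thesis
    by (simp add: contact_term_def[abs_def] form1_def)
qed

section \<open>Vanishing on a common radical\<close>

lemma pair_product_split:
  assumes "k < n"
  shows "pair_product \<omega> n v =
    \<omega> (v (2 * k)) (v (2 * k + 1)) * (\<Prod>i\<in>{..<n} - {k}. \<omega> (v (2 * i)) (v (2 * i + 1)))"
  unfolding pair_product_def using assms by (intro prod.remove) auto

lemma linear_mult_const:
  fixes g :: "'a::real_vector \<Rightarrow> real"
  assumes "linear g"
  shows "linear (\<lambda>x. g x * c)" "linear (\<lambda>x. c * g x)"
  using linear_compose_scale_right[OF assms, of c] by (simp_all add: mult.commute)

lemma pair_product_linear_slot:
  assumes \<omega>: "bilinear \<omega>" and "p < 2 * n"
  shows "linear (\<lambda>x. pair_product \<omega> n (w(p := x)))"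
proof -
  define k where "k = p div 2"
  have k: "k < n" using assms(2) by (auto simp: k_def)
  have p: "p = 2 * k \<or> p = 2 * k + 1" by (auto simp: k_def)
  have "(\<Prod>i\<in>{..<n} - {k}. \<omega> ((w(p := x)) (2 * i)) ((w(p := x)) (2 * i + 1)))
     = (\<Prod>i\<in>{..<n} - {k}. \<omega> (w (2 * i)) (w (2 * i + 1)))" for x
    using p by (intro prod.cong refl) auto
  moreover have "linear (\<lambda>x. \<omega> ((w(p := x)) (2 * k)) ((w(p := x)) (2 * k + 1)))"
    using p \<omega> by (auto simp: bilinear_def)
  ultimately show ?thesis
    unfolding pair_product_split[OF k] by (simp add: linear_mult_const)
qed

lemma contact_term_linear_slot:
  assumes "bilinear \<omega>" "linear \<eta>" "p < 2 * n + 1"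
  shows "linear (\<lambda>x. contact_term \<omega> \<eta> n (w(p := x)))"
proof (cases "p = 2 * n")
  case True
  have "pair_product \<omega> n (w(p := x)) = pair_product \<omega> n w" for x
    using True by (intro pair_product_cong) auto
  then show ?thesis
    using True linear_mult_const(2)[OF assms(2)] by (simp add: contact_term_def)
next
  case False
  then have "p < 2 * n" using assms(3) by simp
  then show ?thesis
    using linear_mult_const(1)[OF pair_product_linear_slot[OF assms(1)]] False
    by (simp add: contact_term_def)
qed

lemma contact_term_radical:
  assumes \<omega>: "\<And>y. \<omega> r y = 0" "\<And>y. \<omega> y r = 0" and "\<eta> r = 0"
    and "p < 2 * n + 1" "w p = r"
  shows "contact_term \<omega> \<eta> n w = 0"
proof (cases "p = 2 * n")
  case True
  then show ?thesis using assms by (simp add: contact_term_def)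
next
  case False
  define k where "k = p div 2"
  have k: "k < n" using assms(4) False by (auto simp: k_def)
  have p: "p = 2 * k \<or> p = 2 * k + 1" by (auto simp: k_def)
  then have "\<omega> (w (2 * k)) (w (2 * k + 1)) = 0"
    using assms by auto
  then show ?thesis
    using pair_product_split[OF k, of \<omega> w] by (simp add: contact_term_def)
qed

lemma alternation_contact_term_radical:
  assumes "\<And>y. \<omega> r y = 0" "\<And>y. \<omega> y r = 0" "\<eta> r = 0" "j < 2 * n + 1"
  shows "alternation (2 * n + 1) (contact_term \<omega> \<eta> n) (v(j := r)) = 0"
  unfolding alternation_def
proof (intro sum.neutral ballI)
  fix \<sigma> assume "\<sigma> \<in> {\<sigma>. \<sigma> permutes {..<2 * n + 1}}"
  then have \<sigma>: "\<sigma> permutes {..<2 * n + 1}" by simp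
  have "contact_term \<omega> \<eta> n (\<lambda>i. (v(j := r)) (\<sigma> i)) = 0"
    unfolding update_permute[OF \<sigma>]
    by (rule contact_term_radical[where r = r and p = "inv \<sigma> j"])
      (use assms inv_permutes_lessThan[OF \<sigma> assms(4)] in auto)
  then show "of_int (sign \<sigma>) * contact_term \<omega> \<eta> n (\<lambda>i. (v(j := r)) (\<sigma> i)) = 0"
    by simp
qed

text \<open>
  Translation from families without nontrivial relation to sets, where bases and dimensions live.
  Injectivity is part of the conclusion since a repeated vector is lost in the image.
\<close>

lemma independent_family:
  fixes v :: "nat \<Rightarrow> 'a::real_vector"
  assumes v: "\<And>c i. (\<Sum>i<N. c i *\<^sub>R v i) = 0 \<Longrightarrow> i < N \<Longrightarrow> c i = 0"
  shows "inj_on v {..<N}" "independent (v ` {..<N})"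
proof -
  show inj: "inj_on v {..<N}"
  proof (rule inj_onI, rule ccontr)
    fix i j assume ij: "i \<in> {..<N}" "j \<in> {..<N}" "v i = v j" "i \<noteq> j"
    have "(\<Sum>k<N. ((if k = i then 1 else 0) - (if k = j then 1 else 0)) *\<^sub>R v k)
        = (\<Sum>k<N. if k = i then v k else 0) - (\<Sum>k<N. if k = j then v k else 0)"
      unfolding sum_subtractf[symmetric] by (intro sum.cong) auto
    also have "\<dots> = 0" using ij by simp
    finally show False using v[of "\<lambda>k. (if k = i then 1 else 0) - (if k = j then 1 else 0)" i] ij
      by simp
  qed
  show "independent (v ` {..<N})"
  proof (rule independent_if_scalars_zero)
    fix c x assume "(\<Sum>x\<in>v ` {..<N}. c x *\<^sub>R x) = 0" and x: "x \<in> v ` {..<N}"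
    then have "(\<Sum>i<N. c (v i) *\<^sub>R v i) = 0"
      using inj by (simp add: sum.reindex)
    then show "c x = 0" using v[of "\<lambda>i. c (v i)"] x by auto
  qed simp
qed

lemma family_relation:
  fixes v :: "nat \<Rightarrow> 'a::real_vector"
  assumes "finite B" "span B = (UNIV :: 'a set)" "card B < N"
  obtains c i where "i < N" "c i \<noteq> 0" "(\<Sum>i<N. c i *\<^sub>R v i) = 0"
proof (rule ccontr)
  assume "\<not> thesis"
  then have v: "\<And>c i. (\<Sum>i<N. c i *\<^sub>R v i) = 0 \<Longrightarrow> i < N \<Longrightarrow> c i = 0"
    using that by blast
  have "inj_on v {..<N}" "independent (v ` {..<N})"
    using independent_family[of v N] v by blast+
  then have "card (v ` {..<N}) \<le> card B" "card (v ` {..<N}) = N"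
    using independent_span_bound[OF assms(1), of "v ` {..<N}"] assms(2)
      card_image[of v "{..<N}"] by simp_all
  then show False using assms(3) by simp
qed

text \<open>
  The form vanishes on families containing \<open>u\<close>, because \<open>u\<close> lies in the radical of \<open>\<omega>\<close> and in
  the kernel of \<open>\<eta>\<close>; every family reduces to such a one. The \<open>2n + 2\<close> vectors
  \<open>v 0, \<dots>, v (2n), u\<close> are related; since \<open>u \<noteq> 0\<close>, some \<open>v j\<close> occurs in the relation, and up to a
  nonzero factor \<open>v j\<close> may be exchanged for a multiple of \<open>u\<close>.
\<close>

lemma alternation_contact_term_vanishes:
  fixes \<omega> :: "'a::real_vector \<Rightarrow> 'a \<Rightarrow> real"
  assumes \<omega>: "bilinear \<omega>" and \<eta>: "linear \<eta>"
    and u: "u \<noteq> 0" "\<And>y. \<omega> u y = 0" "\<And>y. \<omega> y u = 0" "\<eta> u = 0"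
    and B: "finite B" "span B = (UNIV :: 'a set)" "card B \<le> 2 * n + 1"
  shows "alternation (2 * n + 1) (contact_term \<omega> \<eta> n) v = 0"
proof -
  let ?m = "2 * n + 1"
  have "card B < Suc ?m" using B(3) by simp
  then obtain c i where i: "i < Suc ?m" "c i \<noteq> 0"
    and c: "(\<Sum>i<Suc ?m. c i *\<^sub>R (v(?m := u)) i) = 0"
    by (rule family_relation[OF B(1,2), where v = "v(?m := u)"])
  have "(\<Sum>i<Suc ?m. c i *\<^sub>R (v(?m := u)) i) = (\<Sum>i<?m. c i *\<^sub>R v i) + c ?m *\<^sub>R u"
    by (subst sum.lessThan_Suc) (auto intro!: sum.cong)
  \<comment> \<open>The relation, solved for the part without \<open>u\<close>, gives a vector of the common radical.\<close>
  then have r: "(\<Sum>i<?m. c i *\<^sub>R v i) = - c ?m *\<^sub>R u"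
    using c by (simp only: eq_neg_iff_add_eq_0 scaleR_minus_left)
  obtain j where j: "j < ?m" "c j \<noteq> 0"
  proof (rule ccontr)
    assume "\<not> thesis"
    then have z: "\<forall>j<?m. c j = 0" using that by blast
    then have "c ?m *\<^sub>R u = 0" using r by simp
    then show False using u(1) i z less_Suc_eq[of i ?m] by auto
  qed
  have "c j * alternation ?m (contact_term \<omega> \<eta> n) v
      = alternation ?m (contact_term \<omega> \<eta> n) (v(j := - c ?m *\<^sub>R u))"
    unfolding r[symmetric]
    by (rule alternation_combination_slot[symmetric, OF contact_term_linear_slot[OF \<omega> \<eta>] j(1)])
  also have "\<dots> = 0"
    using u \<omega> \<eta> j(1)
    by (intro alternation_contact_term_radical)
      (simp_all add: bilinear_lmul bilinear_rmul linear_scale bilinear_lneg bilinear_rneg linear_neg)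
  finally show ?thesis using j(2) by simp
qed

section \<open>Hyperbolic sequences\<close>

text \<open>
  The involution exchanging \<open>2i\<close> and \<open>2i + 1\<close>. It encodes symplectic bases as sequences whose
  consecutive entries are paired, in the order in which \<open>pair_product\<close> groups its arguments.
\<close>

definition partner :: "nat \<Rightarrow> nat" where
  "partner i = (if even i then i + 1 else i - 1)"

lemma partner_even [simp]: "partner (2 * i) = Suc (2 * i)"
  and partner_odd [simp]: "partner (Suc (2 * i)) = 2 * i"
  by (simp_all add: partner_def)

lemma partner_partner [simp]: "partner (partner i) = i"
  by (auto simp: partner_def)

lemma even_partner [simp]: "even (partner i) \<longleftrightarrow> odd i"
  by (auto simp: partner_def)

lemma partner_less [simp]: "partner i < 2 * n \<longleftrightarrow> i < 2 * n"
  by (cases "even i") (auto simp: partner_def elim!: evenE oddE)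

definition hyperbolic :: "('a \<Rightarrow> 'a \<Rightarrow> real) \<Rightarrow> nat \<Rightarrow> (nat \<Rightarrow> 'a) \<Rightarrow> bool" where
  "hyperbolic \<omega> n v \<longleftrightarrow>
     (\<forall>i<2 * n. \<forall>j<2 * n. \<omega> (v i) (v j) = (if j = partner i then (-1) ^ i else 0))"

text \<open>
  The projection onto the span of a hyperbolic sequence along its \<open>\<omega>\<close>-orthogonal complement.
\<close>

definition hyperbolic_part ::
    "('a \<Rightarrow> 'a \<Rightarrow> real) \<Rightarrow> nat \<Rightarrow> (nat \<Rightarrow> 'a) \<Rightarrow> 'a \<Rightarrow> 'a::real_vector" where
  "hyperbolic_part \<omega> n v x = (\<Sum>i<2 * n. ((-1) ^ i * \<omega> x (v (partner i))) *\<^sub>R v i)"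

lemma bilinear_combination_left:
  fixes \<omega> :: "'a::real_vector \<Rightarrow> 'a \<Rightarrow> real"
  assumes "bilinear \<omega>"
  shows "\<omega> (\<Sum>i\<in>S. c i *\<^sub>R v i) y = (\<Sum>i\<in>S. c i * \<omega> (v i) y)"
proof -
  interpret linear "\<lambda>x. \<omega> x y" using assms by (simp add: bilinear_def)
  show ?thesis by (simp add: sum scale)
qed

lemma bilinear_combination_right:
  fixes \<omega> :: "'a::real_vector \<Rightarrow> 'a \<Rightarrow> real"
  assumes "bilinear \<omega>"
  shows "\<omega> y (\<Sum>i\<in>S. c i *\<^sub>R v i) = (\<Sum>i\<in>S. c i * \<omega> y (v i))"
proof -
  interpret linear "\<omega> y" using assms by (simp add: bilinear_def)
  show ?thesis by (simp add: sum scale)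
qed

lemma alternating_skew:
  fixes \<omega> :: "'a::real_vector \<Rightarrow> 'a \<Rightarrow> 'b::real_vector"
  assumes "bilinear \<omega>" "\<And>x. \<omega> x x = 0"
  shows "\<omega> x y = - \<omega> y x"
proof -
  have "\<omega> (x + y) (x + y) = \<omega> x x + \<omega> x y + (\<omega> y x + \<omega> y y)"
    by (simp add: bilinear_ladd[OF assms(1)] bilinear_radd[OF assms(1)])
  then show ?thesis by (simp add: assms(2) eq_neg_iff_add_eq_0)
qed

lemma hyperbolic_coefficient:
  assumes \<omega>: "bilinear \<omega>" and v: "hyperbolic \<omega> n v" and j: "j < 2 * n"
  shows "\<omega> (\<Sum>i<2 * n. c i *\<^sub>R v i) (v j) = c (partner j) * (-1) ^ partner j"
proof -
  have "\<omega> (\<Sum>i<2 * n. c i *\<^sub>R v i) (v j)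
      = (\<Sum>i<2 * n. if i = partner j then c i * (-1) ^ i else 0)"
    unfolding bilinear_combination_left[OF \<omega>]
    using v j by (intro sum.cong) (auto simp: hyperbolic_def)
  then show ?thesis using j by simp
qed

lemma hyperbolic_part_pairing:
  assumes "bilinear \<omega>" "hyperbolic \<omega> n v" "j < 2 * n"
  shows "\<omega> (hyperbolic_part \<omega> n v x) (v j) = \<omega> x (v j)"
  unfolding hyperbolic_part_def hyperbolic_coefficient[OF assms]
  by (simp flip: power_add)

lemma hyperbolic_relation_trivial:
  assumes "bilinear \<omega>" "hyperbolic \<omega> n v" "(\<Sum>i<2 * n. c i *\<^sub>R v i) = 0" "i < 2 * n"
  shows "c i = 0"
  using hyperbolic_coefficient[OF assms(1,2), of "partner i" c] assms
  by (simp add: bilinear_lzero)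

text \<open>
  Inductive step of the symplectic Gram-Schmidt process.
\<close>

lemma hyperbolic_extend:
  assumes "bilinear \<omega>" and alt: "\<And>x. \<omega> x x = 0" and v: "hyperbolic \<omega> n v"
    and x: "\<And>j. j < 2 * n \<Longrightarrow> \<omega> x (v j) = 0" and y: "\<And>j. j < 2 * n \<Longrightarrow> \<omega> y (v j) = 0"
    and "\<omega> x y = 1"
  shows "hyperbolic \<omega> (Suc n) (v(2 * n := x, 2 * n + 1 := y))"
proof -
  have skew: "\<omega> a b = - \<omega> b a" for a b
    using alternating_skew[OF assms(1) alt] .
  have x': "\<omega> (v j) x = 0" and y': "\<omega> (v j) y = 0" if "j < 2 * n" for j
    using x[OF that] y[OF that] skew[of "v j"] by auto
  have yx: "\<omega> y x = -1" using skew[of y x] assms(6) by simp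
  define b where "b = v(2 * n := x, 2 * n + 1 := y)"
  have b: "b j = v j" if "j < 2 * n" for j using that by (simp add: b_def)
  have bx: "b (2 * n) = x" and b_y: "b (2 * n + 1) = y" by (simp_all add: b_def)
  have "\<omega> (b i) (b j) = (if j = partner i then (-1) ^ i else 0)"
    if ij: "i < 2 * Suc n" "j < 2 * Suc n" for i j
  proof -
    have no_pair: "j \<noteq> partner i" if "(j < 2 * n) \<noteq> (i < 2 * n)" using that by auto
    have "i < 2 * n \<or> i = 2 * n \<or> i = 2 * n + 1" "j < 2 * n \<or> j = 2 * n \<or> j = 2 * n + 1"
      using ij by auto
    then consider "i < 2 * n" "j < 2 * n" | "i < 2 * n" "j = 2 * n" | "i < 2 * n" "j = 2 * n + 1"
      | "i = 2 * n" "j < 2 * n" | "i = 2 * n" "j = 2 * n" | "i = 2 * n" "j = 2 * n + 1"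
      | "i = 2 * n + 1" "j < 2 * n" | "i = 2 * n + 1" "j = 2 * n" | "i = 2 * n + 1" "j = 2 * n + 1"
      by blast
    then show ?thesis
    proof cases
      case 1
      then show ?thesis using v by (simp add: b hyperbolic_def)
    next
      case 2
      then have "j \<noteq> partner i" by (intro no_pair) simp
      then show ?thesis using 2 b x' bx by simp
    next
      case 3
      then have "j \<noteq> partner i" by (intro no_pair) simp
      then show ?thesis using 3 b y' b_y by simp
    next
      case 4
      then have "j \<noteq> partner i" by (intro no_pair) simp
      then show ?thesis using 4 b x bx by simp
    next
      case 5
      then show ?thesis using bx alt by simp
    next
      case 6
      then show ?thesis using bx b_y assms(6) by simp
    next
      case 7
      then have "j \<noteq> partner i" by (intro no_pair) simp
      then show ?thesis using 7 b y b_y by simp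
    next
      case 8
      then show ?thesis using bx b_y yx by simp
    next
      case 9
      then show ?thesis using b_y alt by simp
    qed
  qed
  then show ?thesis unfolding hyperbolic_def b_def by blast
qed

text \<open>
  Hyperbolic sequences are independent, so there is a longest one. If it did not span, some
  vector would have a nonzero component \<open>x'\<close> orthogonal to it, and nondegeneracy would give a
  vector pairing nontrivially with \<open>x'\<close>; after projection and scaling the two extend the sequence.
\<close>

lemma hyperbolic_basis_exists:
  fixes \<omega> :: "'a::real_vector \<Rightarrow> 'a \<Rightarrow> real"
  assumes \<omega>: "bilinear \<omega>" and alt: "\<And>x. \<omega> x x = 0"
    and nondeg: "\<And>x. (\<And>y. \<omega> x y = 0) \<Longrightarrow> x = 0"
    and B: "finite B" "span B = (UNIV :: 'a set)"
  obtains n v where "hyperbolic \<omega> n v" "\<And>x. hyperbolic_part \<omega> n v x = x"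
proof -
  have bound: "k \<le> card B" if k: "\<exists>v. hyperbolic \<omega> k v" for k
  proof (rule ccontr)
    assume "\<not> k \<le> card B"
    then have "card B < 2 * k" by simp
    moreover obtain v where "hyperbolic \<omega> k v" using k ..
    ultimately show False
      using family_relation[OF B, of "2 * k" v] hyperbolic_relation_trivial[OF \<omega>] by metis
  qed
  have "\<exists>v. hyperbolic \<omega> 0 v" by (simp add: hyperbolic_def)
  then obtain n where n: "\<exists>v. hyperbolic \<omega> n v" and max: "\<And>k. \<exists>v. hyperbolic \<omega> k v \<Longrightarrow> k \<le> n"
    using ex_has_greatest_nat[of "\<lambda>k. \<exists>v. hyperbolic \<omega> k v" 0 id "Suc (card B)"] bound
    unfolding less_Suc_eq_le id_def by blast
  obtain v where v: "hyperbolic \<omega> n v" using n ..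
  have orth: "\<omega> (z - hyperbolic_part \<omega> n v z) (v j) = 0" if "j < 2 * n" for z j
    using hyperbolic_part_pairing[OF \<omega> v that] by (simp add: bilinear_lsub[OF \<omega>])
  have "hyperbolic_part \<omega> n v x = x" for x
  proof (rule ccontr)
    define x' where "x' = x - hyperbolic_part \<omega> n v x"
    assume "hyperbolic_part \<omega> n v x \<noteq> x"
    then have "x' \<noteq> 0" by (simp add: x'_def)
    then obtain z where z: "\<omega> x' z \<noteq> 0" using nondeg by blast
    have x': "\<omega> x' (v j) = 0" if "j < 2 * n" for j
      unfolding x'_def by (rule orth[OF that])
    have "\<omega> x' (hyperbolic_part \<omega> n v z) = 0"
      unfolding hyperbolic_part_def bilinear_combination_right[OF \<omega>]
      by (intro sum.neutral) (simp add: x')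
    then have one: "\<omega> x' ((1 / \<omega> x' z) *\<^sub>R (z - hyperbolic_part \<omega> n v z)) = 1"
      using z by (simp add: bilinear_rmul[OF \<omega>] bilinear_rsub[OF \<omega>])
    have y: "\<omega> ((1 / \<omega> x' z) *\<^sub>R (z - hyperbolic_part \<omega> n v z)) (v j) = 0" if "j < 2 * n" for j
      using orth[OF that, of z] by (simp add: bilinear_lmul[OF \<omega>])
    show False
      using max[of "Suc n"] hyperbolic_extend[OF \<omega> alt v x' y one] by auto
  qed
  then show thesis using that v by blast
qed

section \<open>Evaluation on a hyperbolic sequence\<close>

text \<open>
  Here \<open>\<sigma>\<close> permutes whole pairs and keeps their order. It acts by one permutation \<open>\<tau>\<close> on the even
  numbers and by the conjugate of \<open>\<tau>\<close> under the partner involution on the odd ones, and these two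
  have equal signs.
\<close>

lemma sign_even_partner_permutation:
  assumes \<sigma>: "\<sigma> permutes {..<2 * n}"
    and partner: "\<And>i. i < n \<Longrightarrow> \<sigma> (2 * i + 1) = partner (\<sigma> (2 * i))"
    and even: "\<And>i. i < n \<Longrightarrow> even (\<sigma> (2 * i))"
  shows "sign \<sigma> = 1"
proof -
  define s where "s x = (if x < 2 * n then partner x else x)" for x
  define \<tau> where "\<tau> x = (if x < 2 * n \<and> even x then \<sigma> x else x)" for x
  have less: "\<sigma> x < 2 * n \<longleftrightarrow> x < 2 * n" for x
    using permutes_in_image[OF \<sigma>] by simp
  have even': "even (\<sigma> x)" if "x < 2 * n" "even x" for x
    using even[of "x div 2"] that by (auto elim!: evenE)
  have partner': "\<sigma> x = partner (\<sigma> (partner x))" if "x < 2 * n" "odd x" for x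
    using partner[of "x div 2"] that by (auto elim!: oddE)
  have s: "s permutes {..<2 * n}"
    by (rule bij_imp_permutes) (auto simp: s_def intro!: bij_betw_byWitness[where f' = s])
  have "inj_on \<tau> {..<2 * n}"
  proof (rule inj_onI)
    fix x y assume "x \<in> {..<2 * n}" "y \<in> {..<2 * n}" "\<tau> x = \<tau> y"
    then show "x = y"
      using even'[of x] even'[of y] injD[OF permutes_inj[OF \<sigma>], of x y]
      by (cases "even x"; cases "even y") (auto simp: \<tau>_def)
  qed
  moreover have "\<tau> ` {..<2 * n} \<subseteq> {..<2 * n}"
    using less by (auto simp: \<tau>_def)
  ultimately have "bij_betw \<tau> {..<2 * n} {..<2 * n}"
    by (simp add: bij_betw_def endo_inj_surj)
  then have \<tau>: "\<tau> permutes {..<2 * n}"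
    by (rule bij_imp_permutes) (simp add: \<tau>_def)
  have "\<sigma> x = (\<tau> \<circ> (s \<circ> (\<tau> \<circ> s))) x" for x
  proof (cases "x < 2 * n")
    case True
    then show ?thesis
      using even'[of "partner x"] partner'[of x] less
      by (cases "even x") (auto simp: \<tau>_def s_def)
  next
    case False
    then show ?thesis
      using permutes_not_in[OF \<sigma>, of x] by (simp add: \<tau>_def s_def)
  qed
  then have "\<sigma> = \<tau> \<circ> (s \<circ> (\<tau> \<circ> s))" ..
  then have "sign \<sigma> = sign \<tau> * (sign s * (sign \<tau> * sign s))"
    using \<tau> s by (simp add: sign_compose_permutes permutes_compose)
  then show ?thesis by (simp add: sign_def)
qed

text \<open>
  Each pair that \<open>\<sigma>\<close> maps with reversed order costs one transposition; undoing these one at a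
  time reduces to a permutation that keeps the order inside the pairs. The product counts the
  reversals, and equals the product of the values of \<open>\<omega>\<close> on a permuted hyperbolic sequence.
\<close>

lemma sign_partner_permutation:
  assumes "\<sigma> permutes {..<2 * n}"
    and "\<And>i. i < n \<Longrightarrow> \<sigma> (2 * i + 1) = partner (\<sigma> (2 * i))"
  shows "sign \<sigma> = (\<Prod>i<n. (-1) ^ \<sigma> (2 * i))"
  using assms
proof (induction "card {i. i < n \<and> odd (\<sigma> (2 * i))}" arbitrary: \<sigma>)
  case 0
  then have even: "even (\<sigma> (2 * i))" if "i < n" for i
    using that by auto
  then have "(\<Prod>i<n. (-1) ^ \<sigma> (2 * i)) = (1::int)"
    by (intro prod.neutral) simp
  then show ?case
    using sign_even_partner_permutation[OF 0(2,3) even] by simp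
next
  case (Suc k)
  let ?O = "\<lambda>\<sigma>. {i. i < n \<and> odd (\<sigma> (2 * i))}"
  obtain j where j: "j \<in> ?O \<sigma>"
    using Suc.hyps(2) by (metis card.empty equals0I nat.distinct(1))
  \<comment> \<open>Swapping the two places of a reversed pair restores its order and changes one sign in the product.\<close>
  define t where "t = Transposition.transpose (2 * j) (2 * j + 1)"
  have t: "t permutes {..<2 * n}" "sign t = -1"
    using j by (auto simp: t_def permutes_swap_id sign_swap_id)
  have t_other: "t (2 * i) = 2 * i" "t (2 * i + 1) = 2 * i + 1" if "i \<noteq> j" for i
    using that by (auto simp: t_def Transposition.transpose_def; presburger)+
  have t_j: "t (2 * j) = 2 * j + 1" "t (2 * j + 1) = 2 * j"
    by (auto simp: t_def)
  have \<sigma>j: "\<sigma> (2 * j + 1) = partner (\<sigma> (2 * j))" "odd (\<sigma> (2 * j))"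
    using Suc.prems(2) j by auto
  have "?O (\<sigma> \<circ> t) = ?O \<sigma> - {j}"
  proof (intro set_eqI)
    fix i show "i \<in> ?O (\<sigma> \<circ> t) \<longleftrightarrow> i \<in> ?O \<sigma> - {j}"
      using t_other t_j \<sigma>j by (cases "i = j") auto
  qed
  then have card: "k = card (?O (\<sigma> \<circ> t))"
    using Suc.hyps(2) j by simp
  have pair: "(\<sigma> \<circ> t) (2 * i + 1) = partner ((\<sigma> \<circ> t) (2 * i))" if "i < n" for i
    using Suc.prems(2)[OF that] t_other[of i] t_j \<sigma>j by (cases "i = j") auto
  have "sign (\<sigma> \<circ> t) = (\<Prod>i<n. (-1) ^ (\<sigma> \<circ> t) (2 * i))"
    by (rule Suc.hyps(1)[OF card permutes_compose[OF t(1) Suc.prems(1)] pair])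
  also have "\<dots> = (-1) ^ (\<sigma> \<circ> t) (2 * j) * (\<Prod>i\<in>{..<n} - {j}. (-1) ^ (\<sigma> \<circ> t) (2 * i))"
    using j by (intro prod.remove) auto
  also have "\<dots> = - ((-1) ^ \<sigma> (2 * j) * (\<Prod>i\<in>{..<n} - {j}. (-1) ^ \<sigma> (2 * i)))"
    using t_j \<sigma>j t_other by simp
  also have "\<dots> = - (\<Prod>i<n. (-1) ^ \<sigma> (2 * i))"
    using j prod.remove[of "{..<n}" j "\<lambda>i. (-1) ^ \<sigma> (2 * i) :: int"] by simp
  finally show ?case
    using sign_compose_permutes[OF Suc.prems(1) t(1)] t(2) by simp
qed

text \<open>
  If the condition on \<open>\<sigma>\<close> fails for some \<open>i\<close>, then the factor of \<open>\<omega>\<close> with index \<open>i\<close> involves either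
  the radical vector \<open>v (2n)\<close> or two vectors of the hyperbolic sequence that are orthogonal. If it
  holds, the product of the factors of \<open>\<omega>\<close> is the sign of \<open>\<sigma>\<close>, which therefore occurs squared.
\<close>

lemma signed_contact_term_hyperbolic:
  assumes v: "hyperbolic \<omega> n v"
    and u: "\<And>y. \<omega> (v (2 * n)) y = 0" "\<And>y. \<omega> y (v (2 * n)) = 0"
    and \<sigma>: "\<sigma> permutes {..<2 * n + 1}"
  shows "of_int (sign \<sigma>) * contact_term \<omega> \<eta> n (\<lambda>i. v (\<sigma> i))
    = of_bool (\<forall>i<n. \<sigma> (2 * i) < 2 * n \<and> \<sigma> (2 * i + 1) = partner (\<sigma> (2 * i))) * \<eta> (v (2 * n))"
proof (cases "\<forall>i<n. \<sigma> (2 * i) < 2 * n \<and> \<sigma> (2 * i + 1) = partner (\<sigma> (2 * i))")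
  case True
  then have less: "\<sigma> (2 * i) < 2 * n" and partner: "\<sigma> (2 * i + 1) = partner (\<sigma> (2 * i))"
    if "i < n" for i using that by auto
  have less': "\<sigma> q < 2 * n" if "q < 2 * n" for q
  proof (cases "even q")
    case True
    then show ?thesis using less that by (auto elim!: evenE)
  next
    case False
    then obtain i where "q = 2 * i + 1" by (auto elim!: oddE)
    then show ?thesis using less[of i] partner[of i] that by auto
  qed
  have "inv \<sigma> (2 * n) < 2 * n + 1" "\<sigma> (inv \<sigma> (2 * n)) = 2 * n"
    using inv_permutes_lessThan[OF \<sigma>] permutes_inverses(1)[OF \<sigma>] by auto
  \<comment> \<open>All smaller places take smaller values, so only the last place can take the value \<open>2n\<close>.\<close>
  then have fixed: "\<sigma> (2 * n) = 2 * n"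
    using less'[of "inv \<sigma> (2 * n)"] by (cases "inv \<sigma> (2 * n) = 2 * n") auto
  have "\<sigma> permutes {..<2 * n}"
    using fixed less_Suc_eq by (intro permutes_superset[OF \<sigma>]) auto
  then have sign: "sign \<sigma> = (\<Prod>i<n. (-1) ^ \<sigma> (2 * i))"
    using sign_partner_permutation partner by blast
  have "pair_product \<omega> n (\<lambda>i. v (\<sigma> i)) = (\<Prod>i<n. (-1) ^ \<sigma> (2 * i))"
    unfolding pair_product_def using v less less' partner
    by (intro prod.cong) (auto simp: hyperbolic_def)
  then have "pair_product \<omega> n (\<lambda>i. v (\<sigma> i)) = of_int (sign \<sigma>)"
    by (simp add: sign)
  then show ?thesis
    using True fixed by (simp add: contact_term_def mult.assoc[symmetric] flip: of_int_mult)
next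
  case False
  then obtain k where k: "k < n" and not: "\<not> (\<sigma> (2 * k) < 2 * n \<and> \<sigma> (2 * k + 1) = partner (\<sigma> (2 * k)))"
    by blast
  have "\<sigma> (2 * k) < 2 * n + 1" "\<sigma> (2 * k + 1) < 2 * n + 1"
    using permutes_in_image[OF \<sigma>, of "2 * k"] permutes_in_image[OF \<sigma>, of "2 * k + 1"] k by auto
  then consider "\<sigma> (2 * k) = 2 * n" | "\<sigma> (2 * k + 1) = 2 * n"
    | "\<sigma> (2 * k) < 2 * n" "\<sigma> (2 * k + 1) < 2 * n"
    by linarith
  then have "\<omega> (v (\<sigma> (2 * k))) (v (\<sigma> (2 * k + 1))) = 0"
    using not u v by cases (auto simp: hyperbolic_def)
  then have "contact_term \<omega> \<eta> n (\<lambda>i. v (\<sigma> i)) = 0"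
    using pair_product_split[OF k, of \<omega> "\<lambda>i. v (\<sigma> i)"] by (simp add: contact_term_def)
  then show ?thesis using False by simp
qed

text \<open>
  All contributions have the same sign and the identity contributes, so the sum is not zero.
\<close>

lemma alternation_contact_term_hyperbolic:
  assumes "hyperbolic \<omega> n v"
    and "\<And>y. \<omega> (v (2 * n)) y = 0" "\<And>y. \<omega> y (v (2 * n)) = 0"
    and \<eta>: "\<eta> (v (2 * n)) \<noteq> 0"
  shows "alternation (2 * n + 1) (contact_term \<omega> \<eta> n) v \<noteq> 0"
proof -
  let ?S = "{\<sigma>. \<sigma> permutes {..<2 * n + 1}}"
  let ?P = "\<lambda>\<sigma>. \<forall>i<n. \<sigma> (2 * i) < 2 * n \<and> \<sigma> (2 * i + 1) = partner (\<sigma> (2 * i))"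
  define N :: real where "N = (\<Sum>\<sigma>\<in>?S. of_bool (?P \<sigma>))"
  have "alternation (2 * n + 1) (contact_term \<omega> \<eta> n) v = N * \<eta> (v (2 * n))"
    unfolding alternation_def N_def sum_distrib_right
    by (rule sum.cong[OF refl]) (simp only: mem_Collect_eq signed_contact_term_hyperbolic[OF assms(1-3)])
  moreover have "N > 0"
    unfolding N_def
  proof (rule sum_pos2[where i = id])
    show "id \<in> ?S" by (simp add: permutes_id)
  qed simp_all
  ultimately show ?thesis using \<eta> by simp
qed

text \<open>
  If the radical of \<open>\<omega>\<close> is the line spanned by \<open>u\<close>, then \<open>\<omega>\<^sup>n \<and> \<eta>\<close> is a volume form exactly when
  \<open>\<eta>\<close> does not vanish on that line. The dimension is part of the conclusion because a contact
  form asks for the \<open>n\<close> determined by it.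
\<close>

lemma contact_criterion:
  fixes \<omega> :: "'a::real_vector \<Rightarrow> 'a \<Rightarrow> real"
  assumes \<omega>: "bilinear \<omega>" and alt: "\<And>x. \<omega> x x = 0" and \<eta>: "linear \<eta>"
    and w: "hyperbolic \<omega> n w"
    and u: "u \<noteq> 0" "\<And>y. \<omega> u y = 0"
    and span: "span (insert u (w ` {..<2 * n})) = UNIV"
  shows "dim (UNIV :: 'a set) = 2 * n + 1"
    and "wedge (2 * n) 1 (wedge_power2 (form2 \<omega>) n) (form1 \<eta>) \<noteq> (\<lambda>v. 0) \<longleftrightarrow> \<eta> u \<noteq> 0"
proof -
  have u': "\<omega> y u = 0" for y
    using u(2) alternating_skew[OF \<omega> alt, of y u] by simp
  define b where "b = w(2 * n := u)"
  have b: "hyperbolic \<omega> n b" using w by (simp add: hyperbolic_def b_def)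
  have bu: "b (2 * n) = u" by (simp add: b_def)
  have image: "b ` {..<2 * n + 1} = insert u (w ` {..<2 * n})"
    unfolding b_def by (auto simp: less_Suc_eq image_iff)
  have trivial: "c i = 0" if c: "(\<Sum>i<2 * n + 1. c i *\<^sub>R b i) = 0" and i: "i < 2 * n + 1" for c i
  proof -
    have split: "(\<Sum>i<2 * n. c i *\<^sub>R b i) + c (2 * n) *\<^sub>R u = 0"
      using c by (simp add: bu)
    have "c j = 0" if j: "j < 2 * n" for j
    proof -
      \<comment> \<open>Pairing with the partner of \<open>b j\<close> isolates its coefficient, and \<open>u\<close> pairs to zero.\<close>
      have "\<omega> ((\<Sum>i<2 * n. c i *\<^sub>R b i) + c (2 * n) *\<^sub>R u) (b (partner j)) = c j * (-1) ^ j"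
        using hyperbolic_coefficient[OF \<omega> b, of "partner j" c] j
        by (simp add: bilinear_ladd[OF \<omega>] bilinear_lmul[OF \<omega>] u)
      then show ?thesis using split by (simp add: bilinear_lzero[OF \<omega>])
    qed
    moreover from this have "c (2 * n) = 0" using split u(1) by simp
    ultimately show ?thesis using i less_Suc_eq by auto
  qed
  have inj: "inj_on b {..<2 * n + 1}" and indep: "independent (b ` {..<2 * n + 1})"
    using independent_family[of b "2 * n + 1"] trivial by blast+
  have card: "card (b ` {..<2 * n + 1}) = 2 * n + 1" using card_image[OF inj] by simp
  have span': "span (b ` {..<2 * n + 1}) = UNIV" using span image by simp
  show "dim (UNIV :: 'a set) = 2 * n + 1"
    using dim_eq_card[of "b ` {..<2 * n + 1}" UNIV] span' indep card by simp
  have "(\<exists>v. alternation (2 * n + 1) (contact_term \<omega> \<eta> n) v \<noteq> 0) \<longleftrightarrow> \<eta> u \<noteq> 0"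
    using alternation_contact_term_vanishes[OF \<omega> \<eta> u u' _ _ span', of n] card
      alternation_contact_term_hyperbolic[OF b, of \<eta>] u u' bu
    by auto
  then show "wedge (2 * n) 1 (wedge_power2 (form2 \<omega>) n) (form1 \<eta>) \<noteq> (\<lambda>v. 0) \<longleftrightarrow> \<eta> u \<noteq> 0"
    unfolding fun_eq_iff wedge_power2_wedge_form1 by auto
qed


section \<open>Codimension one extensions\<close>

lemma linear_pairI: "linear (\<lambda>x. (x, 0))"
  by (rule linearI) auto

text \<open>
  In the Jacobi sum, the \<open>\<H>\<close> component splits into the Jacobi sum of \<open>br\<close> and, for each argument,
  its \<open>e\<^sub>o\<close> coordinate times the identity required of \<open>\<psi>\<close>; the terms quadratic in \<open>\<psi>\<close> and in the
  coordinates cancel by antisymmetry. The \<open>e\<^sub>o\<close> component reduces to \<open>f([x, y]) = 0\<close>.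
\<close>

lemma lie_algebra_ext_bracket:
  fixes br :: "'h::real_vector \<Rightarrow> 'h \<Rightarrow> 'h"
  assumes br: "lie_algebra br" and d: "extension_datum br \<psi> f"
  shows "lie_algebra (ext_bracket br \<psi> f)"
proof -
  have bil: "bilinear br" and alt: "br x x = 0"
    and jac: "br x (br y z) + br y (br z x) + br z (br x y) = 0" for x y z
    using br unfolding lie_algebra_def by blast+
  have skew: "br x y = - br y x" for x y
    using alternating_skew[OF bil alt] .
  have \<psi>: "linear \<psi>" and f: "linear f" and f_br: "f (br x y) = 0"
    and der: "\<psi> (br x y) = br (\<psi> x) y + br x (\<psi> y) - f x *\<^sub>R \<psi> y + f y *\<^sub>R \<psi> x" for x y
    using d unfolding extension_datum_def by blast+
  note lin = linear_add[OF \<psi>] linear_diff[OF \<psi>] linear_scale[OF \<psi>]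
    linear_add[OF f] linear_diff[OF f] linear_scale[OF f]
    bilinear_ladd[OF bil] bilinear_radd[OF bil] bilinear_lsub[OF bil] bilinear_rsub[OF bil]
    bilinear_lmul[OF bil] bilinear_rmul[OF bil]
  have der': "\<psi> (br x y) = br x (\<psi> y) - br y (\<psi> x) - f x *\<^sub>R \<psi> y + f y *\<^sub>R \<psi> x" for x y
    using der[of x y] skew[of "\<psi> x" y] by simp
  obtain B :: "'h set" where B: "finite B" "span B = UNIV"
    using br unfolding lie_algebra_def by blast
  let ?B = "insert (0, 1) ((\<lambda>x. (x, 0 :: real)) ` B)"
  have "p \<in> span ?B" for p
  proof -
    have "(fst p, 0) \<in> span ((\<lambda>x. (x, 0 :: real)) ` B)"
      using linear_span_image[OF linear_pairI, of B] B(2) by auto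
    then have "(fst p, 0) \<in> span ?B"
      using span_mono[of "(\<lambda>x. (x, 0 :: real)) ` B" ?B] by blast
    moreover have "snd p *\<^sub>R (0, 1) \<in> span ?B"
      by (intro span_scale span_base) simp
    ultimately have "(fst p, 0) + snd p *\<^sub>R (0, 1) \<in> span ?B"
      by (rule span_add)
    then show ?thesis by (cases p) simp
  qed
  then have "finite ?B \<and> span ?B = UNIV" using B(1) by auto
  moreover have "bilinear (ext_bracket br \<psi> f)"
    unfolding bilinear_def
    by (intro conjI allI linearI) (simp_all add: ext_bracket_def lin algebra_simps)
  moreover have "ext_bracket br \<psi> f p p = 0" for p
    by (simp add: ext_bracket_def alt zero_prod_def)
  moreover have "ext_bracket br \<psi> f p (ext_bracket br \<psi> f q r)
      + ext_bracket br \<psi> f q (ext_bracket br \<psi> f r p)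
      + ext_bracket br \<psi> f r (ext_bracket br \<psi> f p q) = 0" for p q r
    using jac[of "fst p" "fst q" "fst r"]
    by (simp add: ext_bracket_def lin der' f_br zero_prod_def algebra_simps)
  ultimately show ?thesis unfolding lie_algebra_def by blast
qed

lemma lie_diff_bilinear:
  assumes "lie_algebra br" "linear \<eta>"
  shows "bilinear (lie_diff br \<eta>)" "lie_diff br \<eta> x x = 0"
proof -
  have bil: "bilinear br" "br x x = 0"
    using assms(1) unfolding lie_algebra_def by blast+
  show "bilinear (lie_diff br \<eta>)"
    unfolding bilinear_def lie_diff_def
    by (intro conjI allI linearI)
      (simp_all add: bilinear_ladd[OF bil(1)] bilinear_radd[OF bil(1)] bilinear_lmul[OF bil(1)]
        bilinear_rmul[OF bil(1)] linear_add[OF assms(2)] linear_scale[OF assms(2)])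
  show "lie_diff br \<eta> x x = 0"
    using bil(2) linear_0[OF assms(2)] by (simp add: lie_diff_def)
qed

text \<open>
  Expanding \<open>y\<close> in the hyperbolic basis writes \<open>\<phi> y\<close> as \<open>\<omega> y g\<close> with \<open>g\<close> the combination of the
  partners weighted by the values of \<open>\<phi>\<close>; the sign from exchanging the arguments gives \<open>h = - g\<close>.
\<close>

lemma hyperbolic_part_represents:
  assumes \<omega>: "bilinear \<omega>" and alt: "\<And>x. \<omega> x x = 0"
    and part: "\<And>x. hyperbolic_part \<omega> n v x = x" and \<phi>: "linear \<phi>"
  obtains h where "\<And>y. \<omega> h y = \<phi> y"
proof -
  define g where "g = (\<Sum>i<2 * n. ((-1) ^ i * \<phi> (v i)) *\<^sub>R v (partner i))"
  have "\<omega> (- g) y = \<phi> y" for y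
  proof -
    have "\<phi> y = \<phi> (hyperbolic_part \<omega> n v y)" by (simp add: part)
    also have "\<dots> = (\<Sum>i<2 * n. ((-1) ^ i * \<omega> y (v (partner i))) * \<phi> (v i))"
      by (simp add: hyperbolic_part_def linear_sum[OF \<phi>] linear_scale[OF \<phi>])
    also have "\<dots> = \<omega> y g"
      unfolding g_def bilinear_combination_right[OF \<omega>]
      by (intro sum.cong) (auto simp: mult_ac)
    also have "\<dots> = \<omega> (- g) y"
      using alternating_skew[OF \<omega> alt, of y g] by (simp add: bilinear_lneg[OF \<omega>])
    finally show ?thesis ..
  qed
  then show thesis by (rule that)
qed

text \<open>
  The radical of \<open>\<partial>\<eta>\<^sub>s\<close> is spanned by \<open>u = (h, 1)\<close>, where \<open>h\<close> is chosen to make \<open>u\<close> orthogonal to \<open>\<H>\<close>;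
  orthogonality to \<open>u\<close> itself is automatic. Pairing \<open>h\<close> with \<open>x\<^sub>o\<close> computes \<open>\<alpha> h\<close> and with it \<open>\<eta>\<^sub>s(u)\<close>.
\<close>

lemma contact_form_eta_form_iff:
  fixes br :: "'h::real_vector \<Rightarrow> 'h \<Rightarrow> 'h"
  assumes es: "exact_symplectic br \<alpha>" and xo: "\<And>y. lie_diff br \<alpha> x\<^sub>o y = \<alpha> y"
    and d: "extension_datum br \<psi> f"
  shows "contact_form (ext_bracket br \<psi> f) (eta_form \<alpha> s) \<longleftrightarrow>
    lie_diff br \<alpha> x\<^sub>o (\<psi> x\<^sub>o) + s * (1 + f x\<^sub>o) \<noteq> 0"
proof -
  have br: "lie_algebra br" and \<alpha>: "linear \<alpha>"
    and nondeg: "\<And>x. (\<And>y. lie_diff br \<alpha> x y = 0) \<Longrightarrow> x = 0"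
    using es unfolding exact_symplectic_def by blast+
  have \<psi>: "linear \<psi>" and f: "linear f"
    using d unfolding extension_datum_def by blast+
  define \<omega> where "\<omega> = lie_diff br \<alpha>"
  have \<omega>: "bilinear \<omega>" and alt: "\<omega> x x = 0" for x
    unfolding \<omega>_def using lie_diff_bilinear[OF br \<alpha>] by blast+
  define \<eta> where "\<eta> = eta_form \<alpha> s"
  have \<eta>: "linear \<eta>"
    unfolding \<eta>_def eta_form_def
    by (rule linearI) (simp_all add: linear_add[OF \<alpha>] linear_scale[OF \<alpha>] algebra_simps)
  define \<Omega> where "\<Omega> = lie_diff (ext_bracket br \<psi> f) \<eta>"
  have \<Omega>: "bilinear \<Omega>" and alt': "\<Omega> p p = 0" for p
    unfolding \<Omega>_def using lie_diff_bilinear[OF lie_algebra_ext_bracket[OF br d] \<eta>] by blast+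
  have \<Omega>_eq: "\<Omega> (x, r) (y, t) = \<omega> x y - t * (\<alpha> (\<psi> x) + s * f x) + r * (\<alpha> (\<psi> y) + s * f y)"
    for x y r t
    by (simp add: \<Omega>_def \<omega>_def \<eta>_def lie_diff_def eta_form_def ext_bracket_def
        linear_add[OF \<alpha>] linear_diff[OF \<alpha>] linear_scale[OF \<alpha>] algebra_simps)
  obtain B :: "'h set" where B: "finite B" "span B = UNIV"
    using br unfolding lie_algebra_def by blast
  obtain n v where v: "hyperbolic \<omega> n v" and part: "\<And>x. hyperbolic_part \<omega> n v x = x"
    using hyperbolic_basis_exists[OF \<omega> alt nondeg[folded \<omega>_def] B] by blast
  have "linear (\<lambda>y. - (\<alpha> (\<psi> y) + s * f y))"
    by (rule linearI) (simp_all add: linear_add[OF \<alpha>] linear_scale[OF \<alpha>] linear_add[OF \<psi>]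
        linear_scale[OF \<psi>] linear_add[OF f] linear_scale[OF f] algebra_simps)
  from hyperbolic_part_represents[OF \<omega> alt part this]
  obtain h where h: "\<And>y. \<omega> h y = - (\<alpha> (\<psi> y) + s * f y)" by blast
  define w where "w i = (v i, 0 :: real)" for i
  have w: "hyperbolic \<Omega> n w"
    using v by (simp add: hyperbolic_def w_def \<Omega>_eq)
  \<comment> \<open>The coefficient of \<open>t\<close> in \<open>\<Omega> (h, 1) (y, t)\<close>, up to sign, is \<open>\<omega> h h\<close>.\<close>
  have h0: "\<alpha> (\<psi> h) + s * f h = 0" using h[of h] alt by simp
  have u: "\<Omega> (h, 1) p = 0" for p
    using h0 h[of "fst p"] by (cases p) (simp add: \<Omega>_eq)
  have "p \<in> span (insert (h, 1) (w ` {..<2 * n}))" for p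
  proof -
    \<comment> \<open>Subtracting a multiple of \<open>(h, 1)\<close> moves \<open>p\<close> into \<open>\<H>\<close>, where the hyperbolic basis spans.\<close>
    define y where "y = fst p - snd p *\<^sub>R h"
    have "(y, 0) = (\<Sum>i<2 * n. ((-1) ^ i * \<omega> y (v (partner i))) *\<^sub>R w i)"
      using part[of y] linear_sum[OF linear_pairI, of "\<lambda>i. ((-1) ^ i * \<omega> y (v (partner i))) *\<^sub>R v i" "{..<2 * n}"]
      by (simp add: hyperbolic_part_def w_def)
    then have "(y, 0) \<in> span (insert (h, 1) (w ` {..<2 * n}))"
      by (auto intro!: span_sum span_scale intro: span_base)
    moreover have "snd p *\<^sub>R (h, 1) \<in> span (insert (h, 1) (w ` {..<2 * n}))"
      by (intro span_scale span_base) simp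
    ultimately have "(y, 0) + snd p *\<^sub>R (h, 1) \<in> span (insert (h, 1) (w ` {..<2 * n}))"
      by (rule span_add)
    then show ?thesis by (cases p) (simp add: y_def)
  qed
  then have span: "span (insert (h, 1) (w ` {..<2 * n})) = UNIV" by blast
  have "(h, 1 :: real) \<noteq> 0" by (simp add: zero_prod_def)
  note criterion = contact_criterion[OF \<Omega> alt' \<eta> w this u span]
  have "contact_form (ext_bracket br \<psi> f) \<eta> \<longleftrightarrow> \<eta> (h, 1) \<noteq> 0"
    unfolding contact_form_def \<Omega>_def[symmetric] using \<eta> criterion by auto
  moreover have "\<eta> (h, 1) = lie_diff br \<alpha> x\<^sub>o (\<psi> x\<^sub>o) + s * (1 + f x\<^sub>o)"
  proof -
    have "\<eta> (h, 1) = \<omega> x\<^sub>o h + s" by (simp add: \<eta>_def eta_form_def \<omega>_def xo)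
    also have "\<dots> = \<alpha> (\<psi> x\<^sub>o) + s * f x\<^sub>o + s"
      using alternating_skew[OF \<omega> alt, of x\<^sub>o h] h[of x\<^sub>o] by simp
    finally show ?thesis by (simp add: xo algebra_simps)
  qed
  ultimately show ?thesis by (simp add: \<eta>_def)
qed

text \<open>
  A bracket that extends the one of \<open>\<H>\<close> is determined by \<open>[x, e\<^sub>o]\<close>. The Jacobi identity for
  \<open>(x, 0)\<close>, \<open>(y, 0)\<close>, \<open>(0, 1)\<close> has the two conditions on \<open>(\<psi>, f)\<close> as its components.
\<close>

lemma codim1_extension_datum:
  fixes br :: "'h::real_vector \<Rightarrow> 'h \<Rightarrow> 'h"
  assumes B: "lie_algebra B" and base: "\<And>x y. B (x, 0) (y, 0) = (br x y, 0)"
  defines "\<psi> \<equiv> \<lambda>x. fst (B (x, 0) (0, 1))" and "f \<equiv> \<lambda>x. snd (B (x, 0) (0, 1 :: real))"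
  shows "extension_datum br \<psi> f" "ext_bracket br \<psi> f = B"
proof -
  have bil: "bilinear B" and alt: "B p p = 0"
    and jac: "B p (B q r) + B q (B r p) + B r (B p q) = 0" for p q r
    using B unfolding lie_algebra_def by blast+
  have skew: "B p q = - B q p" for p q
    using alternating_skew[OF bil alt] .
  have e: "B (x, 0) (0, 1) = (\<psi> x, f x)" for x
    by (simp add: \<psi>_def f_def)
  have e': "B (0, 1) (x, 0) = (- \<psi> x, - f x)" for x
    using skew[of "(0, 1)" "(x, 0)"] e[of x] by simp
  have split: "p = (fst p, 0) + snd p *\<^sub>R (0, 1)" for p :: "'h \<times> real"
    by (cases p) simp
  note lin = bilinear_ladd[OF bil] bilinear_radd[OF bil] bilinear_lmul[OF bil] bilinear_rmul[OF bil]
  have br_skew: "br x y = - br y x" for x y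
    using skew[of "(x, 0)" "(y, 0)"] by (simp add: base)
  have eq: "B p q = ext_bracket br \<psi> f p q" for p q
  proof -
    have "B p q = B ((fst p, 0) + snd p *\<^sub>R (0, 1)) ((fst q, 0) + snd q *\<^sub>R (0, 1))"
      using split by simp
    also have "\<dots> = ext_bracket br \<psi> f p q"
      unfolding lin by (simp add: base e e' alt ext_bracket_def)
    finally show ?thesis .
  qed
  then show "ext_bracket br \<psi> f = B" by (simp add: fun_eq_iff)
  have lin_e: "linear (\<lambda>x. B (x, 0) (0, 1))"
    using linear_compose[OF linear_pairI, of "\<lambda>p. B p (0, 1)"] bil
    by (simp add: bilinear_def o_def)
  have "linear \<psi>" "linear f"
    using linear_compose[OF lin_e linear_fst] linear_compose[OF lin_e linear_snd]
    by (simp_all add: \<psi>_def f_def o_def)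
  moreover have "f (br x y) = 0 \<and>
      \<psi> (br x y) = br (\<psi> x) y + br x (\<psi> y) - f x *\<^sub>R \<psi> y + f y *\<^sub>R \<psi> x" for x y
  proof -
    have zero: "br z 0 = 0" "\<psi> 0 = 0" "f 0 = 0" for z
      using bilinear_rzero[OF bil, of "(z, 0)"] base[of z 0] e[of 0] bilinear_lzero[OF bil]
      by (auto simp: zero_prod_def)
    have zero': "br 0 z = 0" for z using br_skew[of 0 z] zero by simp
    have neg: "br z (- z') = - br z z'" for z z'
      using bilinear_rneg[OF bil, of "(z, 0)" "(z', 0)"] base[of z "- z'"] base[of z z'] by simp
    show ?thesis
      using jac[of "(x, 0)" "(y, 0)" "(0, 1)"] br_skew[of "\<psi> x" y]
      by (simp add: eq ext_bracket_def zero zero' neg zero_prod_def algebra_simps)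
  qed
  ultimately show "extension_datum br \<psi> f" unfolding extension_datum_def by blast
qed

theorem theorem1:
  fixes br :: "'h::real_vector \<Rightarrow> 'h \<Rightarrow> 'h"
    and \<alpha> :: "'h \<Rightarrow> real"
    and x\<^sub>o :: 'h
  assumes "exact_symplectic br \<alpha>"
    and "\<forall>y. lie_diff br \<alpha> x\<^sub>o y = \<alpha> y"
  shows "(\<forall>\<psi> f. extension_datum br \<psi> f \<longrightarrow>
            lie_algebra (ext_bracket br \<psi> f) \<and>
            (\<forall>s. contact_form (ext_bracket br \<psi> f) (eta_form \<alpha> s) \<longleftrightarrow>
                 lie_diff br \<alpha> x\<^sub>o (\<psi> x\<^sub>o) + s * (1 + f x\<^sub>o) \<noteq> 0)) \<and>
         bij_betw (\<lambda>(\<psi>, f). ext_bracket br \<psi> f)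
           {(\<psi>, f). extension_datum br \<psi> f \<and>
              (\<exists>s. lie_diff br \<alpha> x\<^sub>o (\<psi> x\<^sub>o) + s * (1 + f x\<^sub>o) \<noteq> 0)}
           {B. lie_algebra B \<and> (\<forall>x y. B (x, 0) (y, 0) = (br x y, 0)) \<and>
              (\<exists>s. contact_form B (eta_form \<alpha> s))}"
proof (intro conjI allI impI)
  fix \<psi> f s
  assume d: "extension_datum br \<psi> f"
  show "lie_algebra (ext_bracket br \<psi> f)"
    using assms(1) d lie_algebra_ext_bracket unfolding exact_symplectic_def by blast
  show "contact_form (ext_bracket br \<psi> f) (eta_form \<alpha> s) \<longleftrightarrow>
      lie_diff br \<alpha> x\<^sub>o (\<psi> x\<^sub>o) + s * (1 + f x\<^sub>o) \<noteq> 0"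
    using contact_form_eta_form_iff[OF assms(1) _ d] assms(2) by blast
next
  let ?D = "{(\<psi>, f). extension_datum br \<psi> f \<and>
      (\<exists>s. lie_diff br \<alpha> x\<^sub>o (\<psi> x\<^sub>o) + s * (1 + f x\<^sub>o) \<noteq> 0)}"
  let ?L = "{B. lie_algebra B \<and> (\<forall>x y. B (x, 0) (y, 0) = (br x y, 0)) \<and>
      (\<exists>s. contact_form B (eta_form \<alpha> s))}"
  have br: "lie_algebra br" using assms(1) unfolding exact_symplectic_def by blast
  have iff: "contact_form (ext_bracket br \<psi> f) (eta_form \<alpha> s) \<longleftrightarrow>
      lie_diff br \<alpha> x\<^sub>o (\<psi> x\<^sub>o) + s * (1 + f x\<^sub>o) \<noteq> 0" if "extension_datum br \<psi> f" for \<psi> f s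
    using contact_form_eta_form_iff[OF assms(1) _ that] assms(2) by blast
  show "bij_betw (\<lambda>(\<psi>, f). ext_bracket br \<psi> f) ?D ?L"
  proof (rule bij_betw_byWitness
      [where f' = "\<lambda>B. (\<lambda>x. fst (B (x, 0) (0, 1)), \<lambda>x. snd (B (x, 0) (0, 1)))"])
    show "\<forall>a\<in>?D. (\<lambda>B. (\<lambda>x. fst (B (x, 0) (0, 1)), \<lambda>x. snd (B (x, 0) (0, 1))))
        ((\<lambda>(\<psi>, f). ext_bracket br \<psi> f) a) = a"
      by (auto simp: ext_bracket_e\<^sub>o[OF br])
    show "\<forall>B\<in>?L. (\<lambda>(\<psi>, f). ext_bracket br \<psi> f)
        ((\<lambda>B. (\<lambda>x. fst (B (x, 0) (0, 1)), \<lambda>x. snd (B (x, 0) (0, 1)))) B) = B"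
      using codim1_extension_datum(2)[of _ br] by auto
    show "(\<lambda>(\<psi>, f). ext_bracket br \<psi> f) ` ?D \<subseteq> ?L"
      using lie_algebra_ext_bracket[OF br] iff by (auto simp: ext_bracket_base)
    show "(\<lambda>B. (\<lambda>x. fst (B (x, 0) (0, 1)), \<lambda>x. snd (B (x, 0) (0, 1)))) ` ?L \<subseteq> ?D"
    proof clarify
      fix B s
      assume B: "lie_algebra B" "\<forall>x y. B (x, 0) (y, 0) = (br x y, 0 :: real)"
        and contact: "contact_form B (eta_form \<alpha> s)"
      note datum = codim1_extension_datum[OF B(1) B(2)[rule_format]]
      show "extension_datum br (\<lambda>x. fst (B (x, 0) (0, 1))) (\<lambda>x. snd (B (x, 0) (0, 1))) \<and>
        (\<exists>s. lie_diff br \<alpha> x\<^sub>o (fst (B (x\<^sub>o, 0) (0, 1))) + s * (1 + snd (B (x\<^sub>o, 0) (0, 1))) \<noteq> 0)"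
        using datum(1) iff[OF datum(1), of s] contact unfolding datum(2) by blast
    qed
  qed
qed

end
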